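(* The following two statements are equivalent. (a) Every finite bridgeless cubic graph has two (not necessarily distinct) perfect matchings $M_1,M_2$ such that $M_1\cap M_2$ does not contain an odd edge-cut. (b) Every infinite bridgeless cubic graph has two (not necessarily distinct) perfect matchings $M_1,M_2$ such that $M_1\cap M_2$ does not contain an odd edge-cut.
   Context: Graphs are simple (no loops, no parallel edges), not necessarily connected, and may be infinite. A graph is cubic if every vertex has degree exactly 3, and bridgeless if it has no edge whose deletion increases the number of connected components. A perfect matching of $G$ is a set $M\subseteq E(G)$ such that every vertex of $G$ is incident with exactly one edge of $M$. An edge-cut of $G$ is a set of edges of the form $E_G(A,B)$, the set of all edges of $G$ with one endpoint in $A$ and the other in $B$, where $\{A,B\}$ is a partition of $V(G)$ into two nonempty sets. An odd edge-cut is an edge-cut that is finite and has odd cardinality. *)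

theory Defs
  imports Main
begin

text \<open>
  A graph is given by its vertex set \<open>V\<close> and its edge set \<open>E\<close>, an edge being the two-element set
  of its endpoints; it is finite or infinite according to whether \<open>V\<close> is.
\<close>

definition simple_graph :: "'a set \<Rightarrow> 'a set set \<Rightarrow> bool" where
  "simple_graph V E \<longleftrightarrow> (\<forall>e\<in>E. e \<subseteq> V \<and> card e = 2)"

definition degree :: "'a set set \<Rightarrow> 'a \<Rightarrow> nat" where
  "degree E v = card {e \<in> E. v \<in> e}"

text \<open>
  A vertex of infinite degree has \<^const>\<open>degree\<close> 0, so that degree 3 does imply that exactly
  three edges are present.
\<close>

definition cubic :: "'a set \<Rightarrow> 'a set set \<Rightarrow> bool" where
  "cubic V E \<longleftrightarrow> (\<forall>v\<in>V. degree E v = 3)"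

definition reachable :: "'a set set \<Rightarrow> 'a \<Rightarrow> 'a \<Rightarrow> bool" where
  "reachable E = (\<lambda>x y. {x, y} \<in> E)\<^sup>*\<^sup>*"

definition components :: "'a set \<Rightarrow> 'a set set \<Rightarrow> 'a set set" where
  "components V E = (\<lambda>u. {v \<in> V. reachable E u v}) ` V"

text \<open>
  Deleting a bridge increases the number of components, in the sense that some component of the
  graph contains more than one component of the graph without the edge. Comparing the total
  numbers of components gives the same notion for finite graphs (see \<open>bridge_iff_card_components\<close>
  below), but would make every graph with infinitely many components bridgeless.
\<close>

definition bridge :: "'a set \<Rightarrow> 'a set set \<Rightarrow> 'a set \<Rightarrow> bool" where
  "bridge V E e \<longleftrightarrow> e \<in> E \<and>
    (\<exists>C \<in> components V E. \<exists>D\<^sub>1 \<in> components V (E - {e}). \<exists>D\<^sub>2 \<in> components V (E - {e}).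
       D\<^sub>1 \<subseteq> C \<and> D\<^sub>2 \<subseteq> C \<and> D\<^sub>1 \<noteq> D\<^sub>2)"

definition bridgeless :: "'a set \<Rightarrow> 'a set set \<Rightarrow> bool" where
  "bridgeless V E \<longleftrightarrow> (\<nexists>e. bridge V E e)"

definition perfect_matching :: "'a set \<Rightarrow> 'a set set \<Rightarrow> 'a set set \<Rightarrow> bool" where
  "perfect_matching V E M \<longleftrightarrow> M \<subseteq> E \<and> (\<forall>v\<in>V. \<exists>!e. e \<in> M \<and> v \<in> e)"

definition edges_between :: "'a set set \<Rightarrow> 'a set \<Rightarrow> 'a set \<Rightarrow> 'a set set" where
  "edges_between E A B = {e \<in> E. \<exists>a\<in>A. \<exists>b\<in>B. e = {a, b}}"

definition edge_cut :: "'a set \<Rightarrow> 'a set set \<Rightarrow> 'a set set \<Rightarrow> bool" where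
  "edge_cut V E F \<longleftrightarrow>
    (\<exists>A B. A \<noteq> {} \<and> B \<noteq> {} \<and> A \<inter> B = {} \<and> A \<union> B = V \<and> F = edges_between E A B)"

definition odd_edge_cut :: "'a set \<Rightarrow> 'a set set \<Rightarrow> 'a set set \<Rightarrow> bool" where
  "odd_edge_cut V E F \<longleftrightarrow> edge_cut V E F \<and> finite F \<and> odd (card F)"

definition has_matching_pair_without_odd_cut :: "'a set \<Rightarrow> 'a set set \<Rightarrow> bool" where
  "has_matching_pair_without_odd_cut V E \<longleftrightarrow>
    (\<exists>M\<^sub>1 M\<^sub>2. perfect_matching V E M\<^sub>1 \<and> perfect_matching V E M\<^sub>2 \<and>
       (\<nexists>F. odd_edge_cut V E F \<and> F \<subseteq> M\<^sub>1 \<inter> M\<^sub>2))"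

lemma reachable_refl: "reachable E u u"
  by (simp add: reachable_def)

lemma reachable_trans: "reachable E u v \<Longrightarrow> reachable E v w \<Longrightarrow> reachable E u w"
  by (simp add: reachable_def)

lemma reachable_sym: "reachable E u v \<Longrightarrow> reachable E v u"
proof -
  have "symp (\<lambda>x y. {x, y} \<in> E)"
    by (simp add: symp_def insert_commute)
  then show "reachable E u v \<Longrightarrow> reachable E v u"
    unfolding reachable_def by (metis symp_rtranclp sympD)
qed

lemma reachable_mono: "E \<subseteq> E' \<Longrightarrow> reachable E u v \<Longrightarrow> reachable E' u v"
  unfolding reachable_def by (rule rtranclp_mono[THEN predicate2D]) auto

lemma bridge_iff_card_components:
  assumes "finite V"
  shows "bridge V E e \<longleftrightarrow> e \<in> E \<and> card (components V E) < card (components V (E - {e}))"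
proof -
  let ?A = "components V (E - {e})"
  define f where "f D = {v \<in> V. \<exists>u\<in>D. reachable E u v}" for D
  have fin: "finite ?A"
    using assms by (simp add: components_def)
  have f_comp: "f {v \<in> V. reachable (E - {e}) u v} = {v \<in> V. reachable E u v}" if "u \<in> V" for u
  proof -
    have "(\<exists>w \<in> {w \<in> V. reachable (E - {e}) u w}. reachable E w v) \<longleftrightarrow> reachable E u v" for v
    proof
      assume "\<exists>w \<in> {w \<in> V. reachable (E - {e}) u w}. reachable E w v"
      then obtain w where w: "reachable (E - {e}) u w" "reachable E w v"
        by auto
      show "reachable E u v"
        by (rule reachable_trans[OF reachable_mono[OF _ w(1)] w(2)]) auto
    qed (use that reachable_refl[of "E - {e}" u] in auto)
    then show ?thesis
      unfolding f_def by simp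
  qed
  have img: "f ` ?A = components V E"
    unfolding components_def image_image using f_comp by (intro image_cong) auto
  have sub: "D \<subseteq> C \<longleftrightarrow> f D = C" if D: "D \<in> ?A" and C: "C \<in> components V E" for C D
  proof -
    obtain u where u: "u \<in> V" "D = {v \<in> V. reachable (E - {e}) u v}"
      using D unfolding components_def by blast
    obtain w where w: "w \<in> V" "C = {v \<in> V. reachable E w v}"
      using C unfolding components_def by blast
    have fD: "f D = {v \<in> V. reachable E u v}"
      using f_comp u by simp
    show ?thesis
    proof
      assume "D \<subseteq> C"
      moreover have "u \<in> D"
        using u reachable_refl by simp
      ultimately have "reachable E w u"
        using w by auto
      then have "reachable E u v \<longleftrightarrow> reachable E w v" for v
        using reachable_trans reachable_sym by metis
      then show "f D = C"
        unfolding fD w(2) by simp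
    next
      assume "f D = C"
      then show "D \<subseteq> C"
        using fD u(2) reachable_mono[of "E - {e}" E] by auto
    qed
  qed
  have "(\<exists>C \<in> components V E. \<exists>D\<^sub>1\<in>?A. \<exists>D\<^sub>2\<in>?A. D\<^sub>1 \<subseteq> C \<and> D\<^sub>2 \<subseteq> C \<and> D\<^sub>1 \<noteq> D\<^sub>2)
      \<longleftrightarrow> (\<exists>C \<in> f ` ?A. \<exists>D\<^sub>1\<in>?A. \<exists>D\<^sub>2\<in>?A. f D\<^sub>1 = C \<and> f D\<^sub>2 = C \<and> D\<^sub>1 \<noteq> D\<^sub>2)"
    unfolding img using sub by (intro bex_cong refl) simp
  also have "\<dots> \<longleftrightarrow> \<not> inj_on f ?A"
    unfolding inj_on_def by (simp only: bex_simps ball_simps image_iff Bex_def Ball_def) metis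
  also have "\<dots> \<longleftrightarrow> card (f ` ?A) < card ?A"
    by (simp add: inj_on_iff_eq_card[OF fin] order.strict_iff_order card_image_le[OF fin])
  also have "f ` ?A = components V E"
    by (fact img)
  finally show ?thesis
    by (simp add: bridge_def)
qed

end

theory Submission
  imports Defs "HOL-Analysis.Function_Topology" "HOL-Library.Countable_Set"
begin

text \<open>
  For (b) implies (a), take infinitely many disjoint copies of the finite graph and restrict the
  matchings to one of them.

  For (a) implies (b), each requirement on a pair of edge sets (one edge of each set at a vertex, or
  not containing a given odd cut in the intersection) concerns finitely many edges, so by compactness
  it suffices to satisfy the requirements of finitely many vertices and finitely many odd cuts. Let
  \<open>S\<close> be a finite vertex set containing these vertices and the ends of all edges of these cuts, and
  sort the vertices outside \<open>S\<close> by the sides of the cuts on which they lie. Edges avoiding \<open>S\<close> stay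
  within a class. Replacing each class by a finite bridgeless gadget gives a finite bridgeless cubic
  graph in which the given cuts survive, and a pair of perfect matchings of it restricts to the edges
  meeting \<open>S\<close>.
\<close>

subsection \<open>Cuts\<close>

text \<open>A cut is recorded by one of its sides only. The sides \<open>{}\<close> and
  \<open>V\<close> are not excluded: in a simple graph their boundary is empty, so it is neither odd
  nor a single edge.\<close>

definition boundary :: "'a set set \<Rightarrow> 'a set \<Rightarrow> 'a set set" where
  "boundary E A = {e \<in> E. e \<inter> A \<noteq> {} \<and> \<not> e \<subseteq> A}"

lemma boundary_subset: "boundary E A \<subseteq> E"
  by (auto simp: boundary_def)

lemma boundary_edgeE:
  assumes "simple_graph V E" "e \<in> boundary E A"
  obtains u v where "e = {u, v}" "u \<in> A" "v \<notin> A" "u \<in> V" "v \<in> V" "u \<noteq> v" "e \<in> E"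
proof -
  have e: "e \<in> E" "e \<subseteq> V" "card e = 2" "e \<inter> A \<noteq> {}" "\<not> e \<subseteq> A"
    using assms by (auto simp: boundary_def simple_graph_def)
  then obtain u v where uv: "u \<in> e" "u \<in> A" "v \<in> e" "v \<notin> A" by auto
  moreover have "e = {u, v}"
    using e(3) uv by (auto simp: card_2_iff)
  ultimately show thesis using that e by blast
qed

lemma edges_between_eq_boundary:
  assumes "simple_graph V E" "A \<subseteq> V" "B = V - A"
  shows "edges_between E A B = boundary E A"
proof
  show "edges_between E A B \<subseteq> boundary E A"
    using assms by (auto simp: edges_between_def boundary_def)
  show "boundary E A \<subseteq> edges_between E A B"
    using assms by (auto simp: edges_between_def elim!: boundary_edgeE[OF assms(1)])
qed

text \<open>\<open>card\<close> is 0 on infinite sets, so an odd \<open>card\<close> already makes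
  the cut finite and nonempty, and any of its edges supplies a vertex on each side.\<close>

lemma odd_edge_cut_iff_boundary:
  assumes "simple_graph V E"
  shows "odd_edge_cut V E F \<longleftrightarrow> (\<exists>A\<subseteq>V. F = boundary E A \<and> odd (card F))"
proof
  assume "odd_edge_cut V E F"
  then obtain A B where "A \<inter> B = {}" "A \<union> B = V" "F = edges_between E A B" "odd (card F)"
    by (auto simp: odd_edge_cut_def edge_cut_def)
  moreover from this have "A \<subseteq> V" "B = V - A" by auto
  then have "edges_between E A B = boundary E A"
    by (rule edges_between_eq_boundary[OF assms])
  ultimately show "\<exists>A\<subseteq>V. F = boundary E A \<and> odd (card F)" by blast
next
  assume "\<exists>A\<subseteq>V. F = boundary E A \<and> odd (card F)"
  then obtain A where A: "A \<subseteq> V" "F = boundary E A" "odd (card F)" by blast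
  then have "finite F" "F \<noteq> {}" by (auto intro: card_ge_0_finite odd_pos)
  then obtain u v where "u \<in> A" "v \<in> V - A"
    using A boundary_edgeE[OF assms] by (metis DiffI all_not_in_conv)
  moreover have "F = edges_between E A (V - A)"
    using edges_between_eq_boundary[OF assms] A by auto
  ultimately have "edge_cut V E F"
    unfolding edge_cut_def using A(1) by (intro exI[of _ A] exI[of _ "V - A"]) auto
  then show "odd_edge_cut V E F"
    using A(3) \<open>finite F\<close> by (simp add: odd_edge_cut_def)
qed

lemma has_pair_iff_boundary:
  assumes "simple_graph V E"
  shows "has_matching_pair_without_odd_cut V E \<longleftrightarrow>
    (\<exists>M\<^sub>1 M\<^sub>2. perfect_matching V E M\<^sub>1 \<and> perfect_matching V E M\<^sub>2 \<and>
       (\<forall>A\<subseteq>V. odd (card (boundary E A)) \<longrightarrow> \<not> boundary E A \<subseteq> M\<^sub>1 \<inter> M\<^sub>2))"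
proof -
  have "(\<nexists>F. odd_edge_cut V E F \<and> F \<subseteq> N) \<longleftrightarrow>
      (\<forall>A\<subseteq>V. odd (card (boundary E A)) \<longrightarrow> \<not> boundary E A \<subseteq> N)" for N
    unfolding odd_edge_cut_iff_boundary[OF assms] by auto
  then show ?thesis
    by (simp only: has_matching_pair_without_odd_cut_def)
qed

lemma reachable_closed:
  assumes "reachable E u v" "u \<in> A" "boundary E A = {}"
  shows "v \<in> A"
  using assms(1) unfolding reachable_def
proof (induction rule: rtranclp_induct)
  case (step y z)
  then show ?case using assms(3) by (auto simp: boundary_def)
qed (fact assms(2))

text \<open>For a bridge \<open>e\<close>, the side is one of the components into which a component
  falls apart without \<open>e\<close>: only \<open>e\<close> can leave it, and if nothing left it,
  it would coincide with the other one. Conversely, a side left by \<open>e\<close> alone separates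
  the ends of \<open>e\<close> once \<open>e\<close> is deleted.\<close>

lemma bridge_iff_boundary:
  assumes "simple_graph V E"
  shows "bridge V E e \<longleftrightarrow> (\<exists>A\<subseteq>V. boundary E A = {e})"
proof
  assume "bridge V E e"
  then obtain w u u' where e: "e \<in> E" and V: "w \<in> V" "u \<in> V" "u' \<in> V"
    and sub: "{v \<in> V. reachable (E - {e}) u v} \<subseteq> {v \<in> V. reachable E w v}"
      "{v \<in> V. reachable (E - {e}) u' v} \<subseteq> {v \<in> V. reachable E w v}"
    and ne: "{v \<in> V. reachable (E - {e}) u v} \<noteq> {v \<in> V. reachable (E - {e}) u' v}"
    unfolding bridge_def Defs.components_def by blast
  let ?A = "{v \<in> V. reachable (E - {e}) u v}"
  have step: "y \<in> ?A" if "x \<in> ?A" "{x, y} \<in> E - {e}" for x y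
  proof -
    have "reachable (E - {e}) x y" using that(2) by (auto simp: reachable_def)
    moreover have "y \<in> V" using that(2) assms by (auto simp: simple_graph_def)
    ultimately show ?thesis using that(1) reachable_trans by fastforce
  qed
  have "boundary E ?A \<subseteq> {e}"
  proof
    fix f assume "f \<in> boundary E ?A"
    then obtain x y where "f = {x, y}" "x \<in> ?A" "y \<notin> ?A" "f \<in> E"
      by (rule boundary_edgeE[OF assms])
    then show "f \<in> {e}" using step[of x y] by blast
  qed
  moreover have "boundary E ?A \<noteq> {}"
  proof
    assume empty: "boundary E ?A = {}"
    have "reachable E w u" "reachable E w u'"
      using sub V reachable_refl[of "E - {e}"] by (simp_all add: subset_iff)
    then have "reachable E u u'" using reachable_trans reachable_sym by metis
    then have "u' \<in> ?A"
      by (rule reachable_closed[OF _ _ empty]) (use V reachable_refl[of "E - {e}" u] in simp)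
    then have "reachable (E - {e}) u v \<longleftrightarrow> reachable (E - {e}) u' v" for v
      using reachable_trans[of "E - {e}"] reachable_sym[of "E - {e}"] by blast
    then show False using ne by simp
  qed
  ultimately have "boundary E ?A = {e}" by blast
  then show "\<exists>A\<subseteq>V. boundary E A = {e}" by (intro exI[of _ ?A]) auto
next
  assume "\<exists>A\<subseteq>V. boundary E A = {e}"
  then obtain A where A: "A \<subseteq> V" "boundary E A = {e}" by blast
  have "e \<in> boundary E A" using A(2) by simp
  then obtain u v where uv: "e = {u, v}" "u \<in> A" "v \<notin> A" "u \<in> V" "v \<in> V" "e \<in> E"
    by (rule boundary_edgeE[OF assms])
  let ?C = "{x \<in> V. reachable E u x}"
  let ?D = "\<lambda>u. {x \<in> V. reachable (E - {e}) u x}"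
  have reach: "reachable E u v" using uv by (auto simp: reachable_def)
  have sub: "?D u \<subseteq> ?C" "?D v \<subseteq> ?C"
    using reachable_mono[of "E - {e}" E u] reachable_mono[of "E - {e}" E v] reachable_trans[OF reach] by auto
  have "v \<notin> ?D u"
  proof
    have "boundary (E - {e}) A = {}" using A(2) by (auto simp: boundary_def)
    moreover assume "v \<in> ?D u"
    ultimately show False using reachable_closed[of "E - {e}" u v A] uv by auto
  qed
  moreover have "v \<in> ?D v" using uv(5) reachable_refl[of "E - {e}"] by simp
  ultimately have ne: "?D u \<noteq> ?D v" by metis
  have "?C \<in> Defs.components V E"
    unfolding Defs.components_def by (rule image_eqI[OF refl uv(4)])
  moreover have "?D u \<in> Defs.components V (E - {e})"
    unfolding Defs.components_def by (rule image_eqI[OF refl uv(4)])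
  moreover have "?D v \<in> Defs.components V (E - {e})"
    unfolding Defs.components_def by (rule image_eqI[OF refl uv(5)])
  ultimately show "bridge V E e" unfolding bridge_def using \<open>e \<in> E\<close> ne sub by meson
qed

text \<open>In this form bridgelessness can be compared between graphs through the sizes of their
  cuts.\<close>

lemma bridgeless_iff_boundary:
  assumes "simple_graph V E"
  shows "bridgeless V E \<longleftrightarrow> (\<forall>A\<subseteq>V. card (boundary E A) \<noteq> 1)"
  unfolding bridgeless_def bridge_iff_boundary[OF assms] One_nat_def
  by (auto simp: card_1_singleton_iff)

section \<open>Transport of graphs along injective vertex maps\<close>

lemma boundary_image:
  assumes "inj_on f V" "\<forall>e\<in>E. e \<subseteq> V" "A \<subseteq> V"
  shows "boundary ((`) f ` E) (f ` A) = (`) f ` boundary E A"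
proof -
  have "f v \<in> f ` A \<longleftrightarrow> v \<in> A" if "e \<in> E" "v \<in> e" for e v
    using assms that by (intro inj_on_image_mem_iff[OF assms(1)]) auto
  then have "f ` e \<inter> f ` A = {} \<longleftrightarrow> e \<inter> A = {}" "f ` e \<subseteq> f ` A \<longleftrightarrow> e \<subseteq> A" if "e \<in> E" for e
    using that by (auto simp: disjoint_iff image_subset_iff)
  then have "{e \<in> E. f ` e \<inter> f ` A \<noteq> {} \<and> \<not> f ` e \<subseteq> f ` A} = boundary E A"
    by (simp add: boundary_def cong: conj_cong)
  then show ?thesis by (simp add: boundary_def[of "(`) f ` E"] Compr_image_eq)
qed

lemma inj_on_image_edges:
  assumes "inj_on f V" "simple_graph V E"
  shows "inj_on ((`) f) E"
  using assms(2) by (intro inj_on_subset[OF inj_on_image_Pow[OF assms(1)]]) (auto simp: simple_graph_def)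

lemma simple_graph_image:
  assumes "inj_on f V" "simple_graph V E"
  shows "simple_graph (f ` V) ((`) f ` E)"
  using assms by (auto simp: simple_graph_def card_image inj_on_subset)

lemma cubic_image:
  assumes "inj_on f V" "simple_graph V E" "cubic V E"
  shows "cubic (f ` V) ((`) f ` E)"
  unfolding cubic_def
proof (rule ballI, elim imageE)
  fix v w assume v: "w = f v" "v \<in> V"
  have "{e \<in> (`) f ` E. f v \<in> e} = (`) f ` {e \<in> E. v \<in> e}"
    using assms(1,2) v(2) by (simp add: Compr_image_eq simple_graph_def inj_on_image_mem_iff cong: conj_cong)
  moreover have "card ((`) f ` {e \<in> E. v \<in> e}) = card {e \<in> E. v \<in> e}"
    by (rule card_image) (rule inj_on_subset[OF inj_on_image_edges[OF assms(1,2)]], auto)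
  ultimately show "degree ((`) f ` E) w = 3"
    using assms(3) v by (simp add: cubic_def degree_def)
qed

lemma card_boundary_image:
  assumes "inj_on f V" "simple_graph V E" "A \<subseteq> V"
  shows "card (boundary ((`) f ` E) (f ` A)) = card (boundary E A)"
proof -
  have "\<forall>e\<in>E. e \<subseteq> V" using assms(2) by (simp add: simple_graph_def)
  show ?thesis
    unfolding boundary_image[OF assms(1) \<open>\<forall>e\<in>E. e \<subseteq> V\<close> assms(3)]
    by (intro card_image inj_on_subset[OF inj_on_image_edges[OF assms(1,2)] boundary_subset])
qed

lemma bridgeless_image:
  assumes "inj_on f V" "simple_graph V E" "bridgeless V E"
  shows "bridgeless (f ` V) ((`) f ` E)"
  using assms
  by (simp add: bridgeless_iff_boundary simple_graph_image all_subset_image card_boundary_image)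

text \<open>By \<open>closed\<close>, no edge of \<open>F\<close> leaves the image of
  \<open>V\<close>, so the image is a union of components. Matchings are pulled back edge by edge,
  and a side within the image has only image edges in its boundary. This covers isomorphic graphs as
  well as one copy in a disjoint union.\<close>

lemma has_pair_embedding:
  assumes inj: "inj_on f V" and simple: "simple_graph V E" "simple_graph W F"
    and sub: "f ` V \<subseteq> W" "(`) f ` E \<subseteq> F"
    and closed: "\<And>e. e \<in> F \<Longrightarrow> e \<inter> f ` V \<noteq> {} \<Longrightarrow> e \<in> (`) f ` E"
    and pair: "has_matching_pair_without_odd_cut W F"
  shows "has_matching_pair_without_odd_cut V E"
proof -
  have E: "\<forall>e\<in>E. e \<subseteq> V" using simple(1) by (simp add: simple_graph_def)
  obtain M\<^sub>1 M\<^sub>2 where M: "perfect_matching W F M\<^sub>1" "perfect_matching W F M\<^sub>2"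
    and cut: "\<forall>A\<subseteq>W. odd (card (boundary F A)) \<longrightarrow> \<not> boundary F A \<subseteq> M\<^sub>1 \<inter> M\<^sub>2"
    using pair unfolding has_pair_iff_boundary[OF simple(2)] by (elim exE conjE)
  have pm: "perfect_matching V E {e \<in> E. f ` e \<in> N}" if N: "perfect_matching W F N" for N
    unfolding perfect_matching_def
  proof (intro conjI ballI)
    fix v assume v: "v \<in> V"
    then have "f v \<in> W" using sub(1) by blast
    then have "\<exists>!e. e \<in> N \<and> f v \<in> e" using N by (simp add: perfect_matching_def)
    then obtain e where e: "e \<in> N" "f v \<in> e" and uniq: "\<And>e'. e' \<in> N \<Longrightarrow> f v \<in> e' \<Longrightarrow> e' = e"
      by (elim ex1E) blast
    have "e \<in> F" using N e(1) by (auto simp: perfect_matching_def)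
    then have "e \<in> (`) f ` E" by (rule closed) (use e(2) v in blast)
    then obtain d where d: "d \<in> E" "e = f ` d" by blast
    have "v \<in> d" using e d v inj E by (auto simp: inj_on_image_mem_iff)
    show "\<exists>!d. d \<in> {e \<in> E. f ` e \<in> N} \<and> v \<in> d"
    proof (rule ex1I[of _ d])
      show "d \<in> {e \<in> E. f ` e \<in> N} \<and> v \<in> d"
        using d e(1) \<open>v \<in> d\<close> by simp
      fix d' assume d': "d' \<in> {e \<in> E. f ` e \<in> N} \<and> v \<in> d'"
      then have "f ` d' = f ` d"
        using uniq[of "f ` d'"] d by simp
      then show "d' = d"
        using d' d(1) inj_onD[OF inj_on_image_edges[OF inj simple(1)]] by blast
    qed
  qed auto
  have boundary_F: "boundary F (f ` A) = boundary ((`) f ` E) (f ` A)" if "A \<subseteq> V" for A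
  proof
    show "boundary ((`) f ` E) (f ` A) \<subseteq> boundary F (f ` A)"
      using sub(2) by (auto simp: boundary_def)
    show "boundary F (f ` A) \<subseteq> boundary ((`) f ` E) (f ` A)"
    proof
      fix e assume e: "e \<in> boundary F (f ` A)"
      moreover have "e \<in> (`) f ` E"
        by (rule closed) (use e that in \<open>auto simp: boundary_def\<close>)
      ultimately show "e \<in> boundary ((`) f ` E) (f ` A)" by (simp add: boundary_def)
    qed
  qed
  have "\<not> boundary E A \<subseteq> {e \<in> E. f ` e \<in> M\<^sub>1} \<inter> {e \<in> E. f ` e \<in> M\<^sub>2}"
    if A: "A \<subseteq> V" "odd (card (boundary E A))" for A
  proof -
    have "f ` A \<subseteq> W" using A(1) sub(1) by blast
    moreover have "odd (card (boundary F (f ` A)))"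
      using A boundary_F card_boundary_image[OF inj simple(1)] by simp
    ultimately have "\<not> boundary F (f ` A) \<subseteq> M\<^sub>1 \<inter> M\<^sub>2"
      using cut by simp
    then show ?thesis
      unfolding boundary_F[OF A(1)] boundary_image[OF inj E A(1)] by blast
  qed
  with pm[OF M(1)] pm[OF M(2)] show ?thesis
    unfolding has_pair_iff_boundary[OF simple(1)] by blast
qed

corollary has_pair_image_imp:
  assumes "inj_on f V" "simple_graph V E"
    and "has_matching_pair_without_odd_cut (f ` V) ((`) f ` E)"
  shows "has_matching_pair_without_odd_cut V E"
  by (rule has_pair_embedding[OF assms(1,2) simple_graph_image[OF assms(1,2)] _ _ _ assms(3)]) auto

subsection \<open>Compactness and cyclic permutations\<close>

text \<open>By Tychonoff the Boolean product is compact, and a set whose membership depends on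
  finitely many coordinates is closed, so the finite intersection property applies.\<close>

lemma compactness:
  fixes \<C> :: "('i \<Rightarrow> bool) set set"
  assumes dep: "\<And>C. C \<in> \<C> \<Longrightarrow> \<exists>J. finite J \<and> (\<forall>x y. (\<forall>j\<in>J. x j = y j) \<longrightarrow> x \<in> C \<longrightarrow> y \<in> C)"
    and fip: "\<And>\<F>. finite \<F> \<Longrightarrow> \<F> \<subseteq> \<C> \<Longrightarrow> \<Inter>\<F> \<noteq> {}"
  shows "\<Inter>\<C> \<noteq> {}"
proof -
  have "compactin euclidean (UNIV :: bool set)" by (simp add: finite_imp_compact)
  then have "compactin (product_topology (\<lambda>_. euclidean) UNIV) (Pi\<^sub>E UNIV (\<lambda>_ :: 'i. UNIV :: bool set))"
    unfolding compactin_PiE by blast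
  then have "compact (UNIV :: ('i \<Rightarrow> bool) set)"
    by (simp add: euclidean_product_topology)
  moreover have "closed C" if C: "C \<in> \<C>" for C
  proof -
    obtain J where J: "finite J" "\<forall>x y. (\<forall>j\<in>J. x j = y j) \<longrightarrow> x \<in> C \<longrightarrow> y \<in> C"
      using dep[OF C] by (elim exE conjE)
    have "open (- C)"
    proof (rule openI)
      fix x assume x: "x \<in> - C"
      \<comment> \<open>The basic neighbourhood of all points that agree with \<open>x\<close> on
        \<open>J\<close>; if one of them were in \<open>C\<close>, so would be
        \<open>x\<close>.\<close>
      let ?T = "\<Inter>j\<in>J. (\<lambda>y. y j) -` {x j}"
      have "open ?T"
        by (rule open_INT[OF J(1)], rule ballI, rule open_vimage[OF open_discrete continuous_on_product_coordinates])
      moreover have "?T \<subseteq> - C"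
        using x by (auto dest: J(2)[rule_format, rotated])
      ultimately show "\<exists>T. open T \<and> x \<in> T \<and> T \<subseteq> - C" by blast
    qed
    then show ?thesis by (simp add: closed_def)
  qed
  ultimately have "UNIV \<inter> \<Inter>\<C> \<noteq> {}"
    by (rule compact_imp_fip) (use fip in auto)
  then show ?thesis by simp
qed

text \<open>The permutation is to be a single cycle on each fibre of \<open>t\<close>. This is
  expressed without iterating \<open>\<sigma>\<close>: an invariant set is a union of fibres. A new
  element either starts a fibre as a cycle of length one or is spliced into an existing
  cycle.\<close>

lemma ex_cyclic_on_fibres:
  assumes "finite D"
  shows "\<exists>\<sigma>. bij_betw \<sigma> D D \<and> (\<forall>e\<in>D. t (\<sigma> e) = t e) \<and>
    (\<forall>X\<subseteq>D. \<sigma> ` X \<subseteq> X \<longrightarrow> (\<forall>e\<in>X. \<forall>e'\<in>D. t e' = t e \<longrightarrow> e' \<in> X))"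
  using assms
proof (induction D rule: finite_induct)
  case empty
  then show ?case by auto
next
  case (insert a D)
  from insert.IH obtain \<sigma> where bij: "bij_betw \<sigma> D D" and t: "\<forall>e\<in>D. t (\<sigma> e) = t e"
    and closed: "\<forall>X\<subseteq>D. \<sigma> ` X \<subseteq> X \<longrightarrow> (\<forall>e\<in>X. \<forall>e'\<in>D. t e' = t e \<longrightarrow> e' \<in> X)"
    by (elim exE conjE)
  have cyc: "e' \<in> X" if "X \<subseteq> D" "\<sigma> ` X \<subseteq> X" "e \<in> X" "e' \<in> D" "t e' = t e" for X e e'
    by (rule closed[rule_format, OF that])
  have im: "\<sigma> e \<in> D" if "e \<in> D" for e by (rule bij_betw_apply[OF bij that])
  have inj: "inj_on \<sigma> D" by (rule bij_betw_imp_inj_on[OF bij])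
  show ?case
  proof (cases "\<exists>b\<in>D. t b = t a")
    case False
    let ?\<sigma> = "\<sigma>(a := a)"
    have "inj_on ?\<sigma> (insert a D)"
      using inj im insert.hyps by (auto simp: inj_on_def)
    then have "bij_betw ?\<sigma> (insert a D) (insert a D)"
      using im insert.hyps by (intro bij_betw_imageI endo_inj_surj) auto
    moreover have "\<forall>X\<subseteq>insert a D. ?\<sigma> ` X \<subseteq> X \<longrightarrow> (\<forall>e\<in>X. \<forall>e'\<in>insert a D. t e' = t e \<longrightarrow> e' \<in> X)"
    proof (intro allI impI ballI)
      fix X e e' assume X: "X \<subseteq> insert a D" "?\<sigma> ` X \<subseteq> X" "e \<in> X" "e' \<in> insert a D" "t e' = t e"
      show "e' \<in> X"
      proof (cases "e = a \<or> e' = a")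
        case True
        then show ?thesis using X False by (metis insertE subsetD)
      next
        case ne: False
        have "\<sigma> ` (X - {a}) \<subseteq> X - {a}"
        proof (rule image_subsetI)
          fix d assume d: "d \<in> X - {a}"
          then have "?\<sigma> d \<in> X" using X(2) by blast
          moreover have "\<sigma> d \<in> D" using d X(1) im by auto
          ultimately show "\<sigma> d \<in> X - {a}" using d insert.hyps by auto
        qed
        then have "e' \<in> X - {a}"
          by (rule cyc[rotated]) (use X ne in auto)
        then show ?thesis by blast
      qed
    qed
    moreover have "\<forall>e\<in>insert a D. t (?\<sigma> e) = t e" using t by auto
    ultimately show ?thesis by (intro exI[of _ ?\<sigma>] conjI)
  next
    case True
    then obtain b where b: "b \<in> D" "t b = t a" by blast
    \<comment> \<open>The cycle through \<open>b\<close> now runs from \<open>b\<close> over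
      \<open>a\<close> to the former successor of \<open>b\<close>.\<close>
    let ?\<sigma> = "\<sigma>(b := a, a := \<sigma> b)"
    have "a \<noteq> b" using b insert.hyps by auto
    have "inj_on ?\<sigma> (insert a D)"
      using inj im insert.hyps b by (auto simp: inj_on_def)
    then have "bij_betw ?\<sigma> (insert a D) (insert a D)"
      using im insert.hyps b by (intro bij_betw_imageI endo_inj_surj) auto
    moreover have "\<forall>X\<subseteq>insert a D. ?\<sigma> ` X \<subseteq> X \<longrightarrow> (\<forall>e\<in>X. \<forall>e'\<in>insert a D. t e' = t e \<longrightarrow> e' \<in> X)"
    proof (intro allI impI ballI)
      fix X e e' assume X: "X \<subseteq> insert a D" "?\<sigma> ` X \<subseteq> X" "e \<in> X" "e' \<in> insert a D" "t e' = t e"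
      \<comment> \<open>Bypassing \<open>a\<close> preserves invariance: if \<open>b\<close> is in
        \<open>X\<close>, then so are its successor \<open>a\<close> and the successor
        \<open>\<sigma> b\<close> of \<open>a\<close>.\<close>
      have closed: "\<sigma> ` (X - {a}) \<subseteq> X - {a}"
      proof (rule image_subsetI)
        fix d assume d: "d \<in> X - {a}"
        have aX: "\<sigma> b \<in> X" if "b \<in> X"
          using X(2) that \<open>a \<noteq> b\<close> by (auto simp: image_subset_iff split: if_splits)
        have "\<sigma> d \<in> X" using d X(2) aX by (cases "d = b") (auto simp: image_subset_iff)
        moreover have "\<sigma> d \<in> D" using d X(1) im by auto
        ultimately show "\<sigma> d \<in> X - {a}" using insert.hyps by auto
      qed
      have D: "d' \<in> X" if "d \<in> X - {a}" "d' \<in> D" "t d' = t d" for d d'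
        using cyc[OF _ closed that] X(1) by auto
      \<comment> \<open>Cyclicity of the old \<open>\<sigma>\<close> speaks of elements of
        \<open>D\<close> only; if \<open>e\<close> is \<open>a\<close>, its successor
        \<open>\<sigma> b\<close> stands in for it.\<close>
      obtain d where d: "d \<in> X - {a}" "t d = t e"
      proof (cases "e = a")
        case True
        have "?\<sigma> a \<in> X" using X(2,3) True by blast
        moreover have "\<sigma> b \<noteq> a" using im[OF b(1)] insert.hyps by auto
        ultimately show thesis using that[of "\<sigma> b"] t b True by auto
      qed (use X(3) that in auto)
      show "e' \<in> X"
      proof (cases "e' = a")
        case True
        have "b \<in> X" using D[OF d(1) b(1)] True d b X(5) by auto
        then have "?\<sigma> b \<in> X" using X(2) by blast
        then show ?thesis using True \<open>a \<noteq> b\<close> by simp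
      qed (use D d X(4,5) in auto)
    qed
    moreover have "\<forall>e\<in>insert a D. t (?\<sigma> e) = t e" using t b by auto
    ultimately show ?thesis by (intro exI[of _ ?\<sigma>] conjI)
  qed
qed

subsection \<open>Finite expansions\<close>

text \<open>
  The finite graph built from \<open>G\<close> and a finite \<open>S\<close>: the vertices outside \<open>S\<close> are grouped by a type
  \<open>\<tau>\<close> that is constant along edges avoiding \<open>S\<close>. Contracting each group would give a vertex of
  uncontrolled degree, so an edge \<open>e\<close> leaving \<open>S\<close> ends in a triangle \<open>Port e\<close>, \<open>Lft e\<close>, \<open>Rgt e\<close>
  instead, and the triangles of a group are linked in a ring by the edges from \<open>Rgt e\<close> to
  \<open>Lft (\<sigma> e)\<close>. For two triangles the ring is still a simple graph, which a ring of single vertices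
  would not be.
\<close>

datatype 'v expansion = Old 'v | Port "'v set" | Lft "'v set" | Rgt "'v set"

lemma finite_incident:
  assumes "cubic V E" "v \<in> V"
  shows "finite {e \<in> E. v \<in> e}"
proof -
  have "card {e \<in> E. v \<in> e} = 3"
    using assms by (simp add: cubic_def degree_def)
  then show ?thesis by (intro card_ge_0_finite) simp
qed

lemma finite_boundary:
  assumes "cubic V E" "S \<subseteq> V" "finite S"
  shows "finite (boundary E S)"
proof (rule finite_subset)
  show "boundary E S \<subseteq> (\<Union>v\<in>S. {e \<in> E. v \<in> e})" by (auto simp: boundary_def)
  show "finite (\<Union>v\<in>S. {e \<in> E. v \<in> e})"
    by (rule finite_UN_I[OF assms(3)], rule finite_incident[OF assms(1)]) (use assms(2) in blast)
qed

text \<open>For an edge \<open>e\<close> leaving \<open>S\<close>, the set \<open>e - S\<close> is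
  the singleton of its outer end, so its image under \<open>\<tau>\<close> serves as the type of the
  edge. By \<open>fibre\<close> and \<open>cyclic\<close>, \<open>\<sigma>\<close> runs through the
  edges of each type in one cycle.\<close>

locale vertex_expansion =
  fixes V :: "'v set" and E S and \<tau> :: "'v \<Rightarrow> 't" and \<sigma> :: "'v set \<Rightarrow> 'v set"
  assumes simple: "simple_graph V E"
    and cubic: "cubic V E"
    and bridgeless: "bridgeless V E"
    and S: "S \<subseteq> V" "finite S"
    and type_edge: "e \<in> E \<Longrightarrow> u \<in> e \<Longrightarrow> v \<in> e \<Longrightarrow> u \<notin> S \<Longrightarrow> v \<notin> S \<Longrightarrow> \<tau> u = \<tau> v"
    and bij: "bij_betw \<sigma> (boundary E S) (boundary E S)"
    and fibre: "e \<in> boundary E S \<Longrightarrow> \<tau> ` (\<sigma> e - S) = \<tau> ` (e - S)"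
    and cyclic: "X \<subseteq> boundary E S \<Longrightarrow> \<sigma> ` X \<subseteq> X \<Longrightarrow> e \<in> X \<Longrightarrow> e' \<in> boundary E S \<Longrightarrow>
      \<tau> ` (e' - S) = \<tau> ` (e - S) \<Longrightarrow> e' \<in> X"
begin

abbreviation "D \<equiv> boundary E S"

text \<open>The outer end becomes a port indexed by the edge and not by the vertex, so edges with a
  common outer end still get disjoint triangles.\<close>

definition emb :: "'v set \<Rightarrow> 'v expansion set" where
  "emb e = (\<lambda>v. if v \<in> S then Old v else Port e) ` e"

definition V' :: "'v expansion set" where
  "V' = Old ` S \<union> Port ` D \<union> Lft ` D \<union> Rgt ` D"

definition E' :: "'v expansion set set" where
  "E' = emb ` {e \<in> E. e \<inter> S \<noteq> {}} \<union> (\<lambda>e. {Port e, Lft e}) ` D \<union> (\<lambda>e. {Lft e, Rgt e}) ` D \<union>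
    (\<lambda>e. {Rgt e, Port e}) ` D \<union> (\<lambda>e. {Rgt e, Lft (\<sigma> e)}) ` D"

text \<open>Each triangle goes as a whole to the side of the outer end of its edge.\<close>

definition lift :: "'v set \<Rightarrow> 'v expansion set" where
  "lift A = Old ` (A \<inter> S) \<union> (\<Union>e\<in>{e \<in> D. e - S \<subseteq> A}. {Port e, Lft e, Rgt e})"

text \<open>The sides that can be lifted: the triangles of one class are linked in a ring, so they
  must all lie on one side if no ring edge is to be cut.\<close>

definition saturated :: "'v set \<Rightarrow> bool" where
  "saturated A \<longleftrightarrow> (\<forall>u\<in>V - S. \<forall>v\<in>V - S. \<tau> u = \<tau> v \<longrightarrow> (u \<in> A \<longleftrightarrow> v \<in> A))"

lemma finite_D: "finite D"
  by (rule finite_boundary[OF cubic S])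

lemma finite_V': "finite V'"
  using S finite_D by (simp add: V'_def)

lemma D_edgeE:
  assumes "e \<in> D"
  obtains s c where "e = {s, c}" "s \<in> S" "c \<in> V" "c \<notin> S" "e - S = {c}" "emb e = {Old s, Port e}"
proof -
  obtain s c where sc: "e = {s, c}" "s \<in> S" "c \<notin> S" "c \<in> V"
    by (rule boundary_edgeE[OF simple assms])
  have "e - S = {c}" using sc by auto
  moreover have "emb e = {Old s, Port e}" using sc by (simp add: emb_def insert_commute)
  ultimately show thesis using that sc by simp
qed

lemma D_iff: "e \<in> E \<Longrightarrow> e \<inter> S \<noteq> {} \<Longrightarrow> e \<in> D \<longleftrightarrow> \<not> e \<subseteq> S"
  by (simp add: boundary_def)

lemma in_emb [simp]:
  "Old v \<in> emb e \<longleftrightarrow> v \<in> e \<and> v \<in> S"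
  "Port d \<in> emb e \<longleftrightarrow> d = e \<and> \<not> e \<subseteq> S"
  "Lft d \<notin> emb e" "Rgt d \<notin> emb e"
  by (auto simp: emb_def)

lemma inj_on_emb: "inj_on emb {e \<in> E. e \<inter> S \<noteq> {}}"
proof (rule inj_onI)
  fix d e assume eq: "emb d = emb e"
  show "d = e"
  proof (cases "d \<subseteq> S \<and> e \<subseteq> S")
    case True
    then show ?thesis using eq in_emb(1)[of _ d] in_emb(1)[of _ e] by auto
  next
    case False
    then have "Port d \<in> emb d \<or> Port e \<in> emb e" by simp
    then show ?thesis using eq in_emb(2) by metis
  qed
qed

lemma sigma_D: "e \<in> D \<Longrightarrow> \<sigma> e \<in> D"
  by (rule bij_betw_apply[OF bij])

lemma inj_sigma: "inj_on \<sigma> D"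
  by (rule bij_betw_imp_inj_on[OF bij])

text \<open>A fixed point of \<open>\<sigma>\<close> would be the only edge leaving its fibre, hence a bridge.\<close>

lemma sigma_neq:
  assumes "e \<in> D"
  shows "\<sigma> e \<noteq> e"
proof
  assume fixed: "\<sigma> e = e"
  obtain s c where sc: "e = {s, c}" "s \<in> S" "c \<in> V" "c \<notin> S" "e - S = {c}"
    by (rule D_edgeE[OF assms])
  \<comment> \<open>The whole class of \<open>c\<close>. By \<open>type_edge\<close> an edge can
    leave it only into \<open>S\<close>, and it then has the type of \<open>e\<close>.\<close>
  let ?A = "{v \<in> V - S. \<tau> v = \<tau> c}"
  have "boundary E ?A = {e}"
  proof
    have "c \<in> e \<inter> ?A" "s \<in> e" "s \<notin> ?A" using sc by auto
    moreover have "e \<in> E" using assms boundary_subset by blast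
    ultimately show "{e} \<subseteq> boundary E ?A" unfolding boundary_def by blast
    show "boundary E ?A \<subseteq> {e}"
    proof
      fix d assume "d \<in> boundary E ?A"
      then obtain u v where uv: "d = {u, v}" "u \<in> ?A" "v \<notin> ?A" "v \<in> V" "d \<in> E"
        by (rule boundary_edgeE[OF simple])
      have "v \<in> S"
      proof (rule ccontr)
        assume "v \<notin> S"
        then have "\<tau> u = \<tau> v" using uv type_edge[of d u v] by simp
        then show False using uv \<open>v \<notin> S\<close> by simp
      qed
      then have "d \<in> D" "d - S = {u}" using uv by (auto simp: boundary_def)
      moreover have "\<tau> u = \<tau> c" using uv(2) by simp
      ultimately have "\<tau> ` (d - S) = \<tau> ` (e - S)" using sc(5) by simp
      \<comment> \<open>Since \<open>e\<close> is fixed, \<open>{e}\<close> is invariant under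
        \<open>\<sigma>\<close> and hence contains the whole fibre.\<close>
      then show "d \<in> {e}"
        by (rule cyclic[rotated 4]) (simp_all add: fixed assms \<open>d \<in> D\<close>)
    qed
  qed
  then have "card (boundary E ?A) = 1" by simp
  moreover have "?A \<subseteq> V" by blast
  ultimately show False using bridgeless bridgeless_iff_boundary[OF simple] by blast
qed

section \<open>Lifting cuts to the expansion\<close>

lemma in_lift:
  "Old v \<in> lift A \<longleftrightarrow> v \<in> A \<and> v \<in> S"
  "Port e \<in> lift A \<longleftrightarrow> e \<in> D \<and> e - S \<subseteq> A"
  "Lft e \<in> lift A \<longleftrightarrow> e \<in> D \<and> e - S \<subseteq> A"
  "Rgt e \<in> lift A \<longleftrightarrow> e \<in> D \<and> e - S \<subseteq> A"
  by (auto simp: lift_def)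

lemma lift_subset: "lift A \<subseteq> V'"
  by (auto simp: lift_def V'_def)

text \<open>By \<open>fibre\<close>, consecutive triangles of a ring have outer ends of the same
  type, which a saturated side does not separate.\<close>

lemma sigma_lift:
  assumes "saturated A" "e \<in> D"
  shows "\<sigma> e - S \<subseteq> A \<longleftrightarrow> e - S \<subseteq> A"
proof -
  obtain s c where c: "c \<in> V" "c \<notin> S" "e - S = {c}"
    by (rule D_edgeE[OF assms(2)])
  obtain s' c' where c': "c' \<in> V" "c' \<notin> S" "\<sigma> e - S = {c'}"
    by (rule D_edgeE[OF sigma_D[OF assms(2)]])
  have "\<tau> c' = \<tau> c" using fibre[OF assms(2)] c(3) c'(3) by simp
  then have "c' \<in> A \<longleftrightarrow> c \<in> A"
    using assms(1)[unfolded saturated_def, rule_format] c(1,2) c'(1,2) by blast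
  then show ?thesis using c(3) c'(3) by simp
qed

text \<open>Thus a saturated cut uses only edges that the expansion keeps.\<close>

lemma boundary_touches:
  assumes "saturated A" "e \<in> boundary E A"
  shows "e \<inter> S \<noteq> {}"
proof
  assume disj: "e \<inter> S = {}"
  obtain u v where uv: "e = {u, v}" "u \<in> A" "v \<notin> A" "u \<in> V" "v \<in> V" "e \<in> E"
    by (rule boundary_edgeE[OF simple assms(2)])
  then have "\<tau> u = \<tau> v" using type_edge[of e u v] disj by simp
  then show False using assms(1) uv disj by (auto simp: saturated_def)
qed

text \<open>Triangle edges are not cut because \<open>lift\<close> moves triangles as a whole, and
  ring edges are not cut by \<open>sigma_lift\<close>. What remains are the images under
  \<open>emb\<close>, which are cut exactly when the original edges are.\<close>

lemma boundary_lift: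
  assumes "saturated A"
  shows "boundary E' (lift A) = emb ` boundary E A"
proof -
  \<comment> \<open>The conditional is the vertex that represents \<open>v\<close> in
    \<open>emb e\<close>.\<close>
  have mem: "(if v \<in> S then Old v else Port e) \<in> lift A \<longleftrightarrow> v \<in> A" if "e \<in> E" "e \<inter> S \<noteq> {}" "v \<in> e" for e v
  proof (cases "v \<in> S")
    case False
    then have "e \<in> D" using that by (auto simp: boundary_def)
    then obtain s c where "e - S = {c}" by (rule D_edgeE)
    moreover have "v \<in> e - S" using that False by simp
    ultimately show ?thesis using False \<open>e \<in> D\<close> by (simp add: in_lift)
  qed (simp add: in_lift)
  have cross: "emb e \<inter> lift A \<noteq> {} \<and> \<not> emb e \<subseteq> lift A \<longleftrightarrow> e \<inter> A \<noteq> {} \<and> \<not> e \<subseteq> A"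
    if "e \<in> E" "e \<inter> S \<noteq> {}" for e
  proof -
    have "emb e \<inter> lift A \<noteq> {} \<longleftrightarrow> (\<exists>v\<in>e. v \<in> A)"
      using mem[OF that] unfolding emb_def disjoint_iff bex_simps(7)[symmetric] by blast
    moreover have "emb e \<subseteq> lift A \<longleftrightarrow> (\<forall>v\<in>e. v \<in> A)"
      using mem[OF that] unfolding emb_def by blast
    ultimately show ?thesis by blast
  qed
  show ?thesis
  proof
    show "emb ` boundary E A \<subseteq> boundary E' (lift A)"
    proof (rule image_subsetI)
      fix e assume e: "e \<in> boundary E A"
      then have "e \<in> E" "e \<inter> S \<noteq> {}"
        using boundary_subset[of E A] boundary_touches[OF assms e] by auto
      moreover have "emb e \<in> E'" using calculation by (simp add: E'_def)
      ultimately show "emb e \<in> boundary E' (lift A)"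
        using cross[of e] e by (simp add: boundary_def)
    qed
    show "boundary E' (lift A) \<subseteq> emb ` boundary E A"
    proof
      fix f assume f: "f \<in> boundary E' (lift A)"
      then have "f \<in> E'" and f': "f \<inter> lift A \<noteq> {}" "\<not> f \<subseteq> lift A"
        by (simp_all add: boundary_def)
      then consider e where "f = emb e" "e \<in> E" "e \<inter> S \<noteq> {}" | e where "e \<in> D" "f = {Port e, Lft e}"
        | e where "e \<in> D" "f = {Lft e, Rgt e}" | e where "e \<in> D" "f = {Rgt e, Port e}"
        | e where "e \<in> D" "f = {Rgt e, Lft (\<sigma> e)}"
        unfolding E'_def by (elim UnE imageE) auto
      then show "f \<in> emb ` boundary E A"
      proof cases
        case 1
        then have "e \<in> boundary E A" using cross[of e] f' by (simp add: boundary_def)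
        then show ?thesis using 1 by simp
      next
        case 5
        then show ?thesis using f' sigma_lift[OF assms 5(1)] sigma_D[OF 5(1)] by (auto simp: in_lift)
      qed (use f' in \<open>auto simp: in_lift\<close>)
    qed
  qed
qed

lemma card_boundary_lift:
  assumes "saturated A"
  shows "card (boundary E' (lift A)) = card (boundary E A)"
  unfolding boundary_lift[OF assms]
proof (rule card_image, rule inj_on_subset[OF inj_on_emb])
  show "boundary E A \<subseteq> {e \<in> E. e \<inter> S \<noteq> {}}"
    using boundary_subset[of E A] boundary_touches[OF assms] by auto
qed

section \<open>The expansion is a bridgeless cubic graph\<close>

lemma simple_expansion: "simple_graph V' E'"
  unfolding simple_graph_def
proof
  fix f assume "f \<in> E'"
  then consider e where "f = emb e" "e \<in> E" "e \<inter> S \<noteq> {}" | e where "e \<in> D" "f = {Port e, Lft e}"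
    | e where "e \<in> D" "f = {Lft e, Rgt e}" | e where "e \<in> D" "f = {Rgt e, Port e}"
    | e where "e \<in> D" "f = {Rgt e, Lft (\<sigma> e)}"
    unfolding E'_def by (elim UnE imageE) auto
  then show "f \<subseteq> V' \<and> card f = 2"
  proof cases
    case 1
    show ?thesis
    proof (cases "e \<subseteq> S")
      case True
      then have "f = Old ` e" using 1 by (auto simp: emb_def)
      moreover have "card e = 2" using 1 simple by (simp add: simple_graph_def)
      ultimately show ?thesis using True by (auto simp: V'_def card_image inj_on_def)
    next
      case False
      then have "e \<in> D" using D_iff 1 by simp
      then obtain s c where "s \<in> S" "emb e = {Old s, Port e}" by (rule D_edgeE)
      then show ?thesis using 1 \<open>e \<in> D\<close> by (simp add: V'_def)
    qed
  qed (simp_all add: V'_def sigma_D)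
qed

text \<open>As \<open>\<sigma>\<close> is a bijection, exactly one ring edge enters each
  \<open>Lft e\<close>. By \<open>sigma_neq\<close> a ring edge never coincides with the triangle
  edge between \<open>Lft e\<close> and \<open>Rgt e\<close>.\<close>

lemma cubic_expansion: "cubic V' E'"
  unfolding cubic_def degree_def
proof
  fix x assume "x \<in> V'"
  then consider s where "x = Old s" "s \<in> S" | e where "x = Port e" "e \<in> D"
    | e where "x = Lft e" "e \<in> D" | e where "x = Rgt e" "e \<in> D"
    unfolding V'_def by (elim UnE imageE) auto
  then show "card {f \<in> E'. x \<in> f} = 3"
  proof cases
    case 1
    have "{f \<in> E'. x \<in> f} = emb ` {e \<in> E. s \<in> e}"
      using 1 by (auto simp: E'_def)
    moreover have "card (emb ` {e \<in> E. s \<in> e}) = card {e \<in> E. s \<in> e}"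
      using 1 by (intro card_image inj_on_subset[OF inj_on_emb]) auto
    moreover have "card {e \<in> E. s \<in> e} = 3"
      using cubic 1 S by (auto simp: cubic_def degree_def)
    ultimately show ?thesis by simp
  next
    case 2
    then obtain s c where emb: "emb e = {Old s, Port e}" by (auto elim: D_edgeE)
    have e: "e \<in> E" "e \<inter> S \<noteq> {}" "\<not> e \<subseteq> S" using 2 by (auto simp: boundary_def)
    have "{f \<in> E'. x \<in> f} = {emb e, {Port e, Lft e}, {Rgt e, Port e}}"
      using 2 e by (auto simp: E'_def)
    then show ?thesis by (simp add: emb doubleton_eq_iff)
  next
    case 3
    then obtain d where d: "d \<in> D" "e = \<sigma> d" using bij by (auto simp: bij_betw_def)
    have d_uniq: "d' = d" if "e = \<sigma> d'" "d' \<in> D" for d'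
      by (rule inj_onD[OF inj_sigma]) (use d that in simp_all)
    have "{f \<in> E'. x \<in> f} = {{Port e, Lft e}, {Lft e, Rgt e}, {Rgt d, Lft e}}"
    proof
      show "{f \<in> E'. x \<in> f} \<subseteq> {{Port e, Lft e}, {Lft e, Rgt e}, {Rgt d, Lft e}}"
        unfolding 3(1) E'_def by (auto dest: d_uniq)
      show "{{Port e, Lft e}, {Lft e, Rgt e}, {Rgt d, Lft e}} \<subseteq> {f \<in> E'. x \<in> f}"
        using 3 d by (simp add: E'_def)
    qed
    moreover have "d \<noteq> e" using sigma_neq[OF d(1)] d(2) by simp
    ultimately show ?thesis by (simp add: doubleton_eq_iff)
  next
    case 4
    have "{f \<in> E'. x \<in> f} = {{Lft e, Rgt e}, {Rgt e, Port e}, {Rgt e, Lft (\<sigma> e)}}"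
      using 4 by (auto simp: E'_def)
    then show ?thesis using sigma_neq[OF 4(2)] by (simp add: doubleton_eq_iff)
  qed
qed

text \<open>
  A cut by a single edge splits no triangle, and it splits no ring either, since \<open>\<sigma>\<close> leaves a set of
  triangles as often as it enters it. So it is lifted from a cut of \<open>G\<close>.
\<close>

lemma bridgeless_expansion: "bridgeless V' E'"
  unfolding bridgeless_iff_boundary[OF simple_expansion]
proof (intro allI impI notI)
  fix B assume B: "B \<subseteq> V'" "card (boundary E' B) = 1"
  then obtain f where f: "boundary E' B = {f}" by (auto simp: card_1_singleton_iff)
  have cross: "{x, y} = f" if "{x, y} \<in> E'" "(x \<in> B) \<noteq> (y \<in> B)" for x y
  proof -
    have "{x, y} \<in> boundary E' B" using that by (auto simp: boundary_def)
    then show ?thesis using f by simp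
  qed
  \<comment> \<open>A side that splits a triangle cuts two of its edges, but \<open>f\<close> is the
    only edge cut.\<close>
  have triangle: "(Lft e \<in> B \<longleftrightarrow> Port e \<in> B) \<and> (Rgt e \<in> B \<longleftrightarrow> Port e \<in> B)" if "e \<in> D" for e
  proof -
    have "{Port e, Lft e} \<in> E'" "{Lft e, Rgt e} \<in> E'" "{Rgt e, Port e} \<in> E'"
      using that by (simp_all add: E'_def)
    note this[THEN cross]
    moreover have "{Port e, Lft e} \<noteq> {Lft e, Rgt e}" "{Lft e, Rgt e} \<noteq> {Rgt e, Port e}"
        "{Port e, Lft e} \<noteq> {Rgt e, Port e}"
      by (simp_all add: doubleton_eq_iff)
    ultimately show ?thesis by metis
  qed
  define T where "T = {e \<in> D. Port e \<in> B}"
  have T: "T \<subseteq> D" by (auto simp: T_def)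
  have closed: "\<sigma> ` T \<subseteq> T"
  proof (rule ccontr)
    assume "\<not> \<sigma> ` T \<subseteq> T"
    then obtain d where d: "d \<in> T" "\<sigma> d \<notin> T" by blast
    \<comment> \<open>If \<open>\<sigma>\<close> kept the finite set \<open>D - T\<close> inside
      itself, it would permute it, and \<open>\<sigma> d\<close> would have a second preimage there.
      So ring edges cross the cut in both directions, which makes two cut edges.\<close>
    have "\<not> \<sigma> ` (D - T) \<subseteq> D - T"
    proof
      assume sub: "\<sigma> ` (D - T) \<subseteq> D - T"
      have "\<sigma> ` (D - T) = D - T"
        by (rule endo_inj_surj[OF _ sub inj_on_subset[OF inj_sigma]]) (use finite_D in auto)
      moreover have "\<sigma> d \<in> D - T" using d T sigma_D by blast
      ultimately obtain d' where d': "d' \<in> D - T" "\<sigma> d' = \<sigma> d" by (metis imageE)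
      then have "d' = d" using inj_onD[OF inj_sigma] d(1) T by blast
      then show False using d' d by simp
    qed
    then obtain d' where d': "d' \<in> D" "d' \<notin> T" "\<sigma> d' \<in> T"
      using sigma_D by blast
    have dD: "d \<in> D" using d T by blast
    have "{Rgt d, Lft (\<sigma> d)} = f"
    proof (rule cross)
      show "{Rgt d, Lft (\<sigma> d)} \<in> E'" using dD by (simp add: E'_def)
      show "(Rgt d \<in> B) \<noteq> (Lft (\<sigma> d) \<in> B)"
        using d triangle[OF dD] triangle[OF sigma_D[OF dD]] sigma_D[OF dD] by (simp add: T_def)
    qed
    moreover have "{Rgt d', Lft (\<sigma> d')} = f"
    proof (rule cross)
      show "{Rgt d', Lft (\<sigma> d')} \<in> E'" using d' by (simp add: E'_def)
      show "(Rgt d' \<in> B) \<noteq> (Lft (\<sigma> d') \<in> B)"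
        using d' triangle[OF d'(1)] triangle[OF sigma_D[OF d'(1)]] by (simp add: T_def)
    qed
    ultimately have "{Rgt d, Lft (\<sigma> d)} = {Rgt d', Lft (\<sigma> d')}" by (rule trans[OF _ sym])
    then have "d = d'" by (simp add: doubleton_eq_iff)
    then show False using d d' by simp
  qed
  \<comment> \<open>On \<open>S\<close> this follows \<open>B\<close>; outside, a class is taken
    when one of its triangles lies in \<open>B\<close>. As \<open>T\<close> is invariant,
    \<open>cyclic\<close> then puts all triangles of that class in \<open>B\<close>.\<close>
  define A where "A = {v \<in> S. Old v \<in> B} \<union> {v \<in> V - S. \<exists>e\<in>T. \<tau> ` (e - S) = {\<tau> v}}"
  have sat: "saturated A"
    unfolding saturated_def
  proof (intro ballI impI)
    fix u v assume "u \<in> V - S" "v \<in> V - S" "\<tau> u = \<tau> v"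
    then show "u \<in> A \<longleftrightarrow> v \<in> A" by (simp add: A_def)
  qed
  have A_iff: "e - S \<subseteq> A \<longleftrightarrow> Port e \<in> B" if e: "e \<in> D" for e
  proof -
    obtain s c where c: "c \<in> V" "c \<notin> S" "e - S = {c}" by (rule D_edgeE[OF e])
    have "c \<in> A \<longleftrightarrow> (\<exists>e'\<in>T. \<tau> ` (e' - S) = \<tau> ` (e - S))"
      using c by (simp add: A_def)
    also have "\<dots> \<longleftrightarrow> e \<in> T"
      using cyclic[OF T closed _ e] by metis
    finally show ?thesis using c e by (simp add: T_def)
  qed
  have "x \<in> lift A \<longleftrightarrow> x \<in> B" for x
  proof (cases "x \<in> V'")
    case True
    then consider s where "x = Old s" "s \<in> S" | e where "x = Port e" "e \<in> D"
      | e where "x = Lft e" "e \<in> D" | e where "x = Rgt e" "e \<in> D"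
      unfolding V'_def by (elim UnE imageE) auto
    then show ?thesis
    proof cases
      case 1
      then show ?thesis by (simp add: in_lift A_def)
    qed (simp_all add: in_lift A_iff triangle)
  next
    case False
    then show ?thesis using B(1) lift_subset by blast
  qed
  then have "lift A = B" by blast
  then have "card (boundary E A) = 1"
    using card_boundary_lift[OF sat] B(2) by simp
  moreover have "A \<subseteq> V" using S by (auto simp: A_def)
  ultimately show False using bridgeless bridgeless_iff_boundary[OF simple] by blast
qed

text \<open>Only edges meeting \<open>S\<close> are pulled back, so the result is a matching at the
  vertices of \<open>S\<close> alone. A saturated odd cut in both sets would lift to an odd cut in
  both matchings of the expansion.\<close>

lemma matching_pair_restrict:
  assumes "has_matching_pair_without_odd_cut V' E'"
  shows "\<exists>N\<^sub>1 N\<^sub>2. N\<^sub>1 \<subseteq> E \<and> N\<^sub>2 \<subseteq> E \<and> (\<forall>v\<in>S. (\<exists>!e. e \<in> N\<^sub>1 \<and> v \<in> e) \<and> (\<exists>!e. e \<in> N\<^sub>2 \<and> v \<in> e)) \<and>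
    (\<forall>A. saturated A \<longrightarrow> odd (card (boundary E A)) \<longrightarrow> \<not> boundary E A \<subseteq> N\<^sub>1 \<inter> N\<^sub>2)"
proof -
  obtain M\<^sub>1 M\<^sub>2 where M: "perfect_matching V' E' M\<^sub>1" "perfect_matching V' E' M\<^sub>2"
    and cut: "\<forall>A\<subseteq>V'. odd (card (boundary E' A)) \<longrightarrow> \<not> boundary E' A \<subseteq> M\<^sub>1 \<inter> M\<^sub>2"
    using assms unfolding has_pair_iff_boundary[OF simple_expansion] by (elim exE conjE)
  define N where "N M = {e \<in> E. e \<inter> S \<noteq> {} \<and> emb e \<in> M}" for M
  have match: "\<exists>!e. e \<in> N M \<and> v \<in> e" if M: "perfect_matching V' E' M" and v: "v \<in> S" for M v
  proof -
    have "Old v \<in> V'" using v by (simp add: V'_def)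
    then have "\<exists>!f. f \<in> M \<and> Old v \<in> f" using M by (simp add: perfect_matching_def)
    then obtain f where f: "f \<in> M" "Old v \<in> f" and uniq: "\<And>f'. f' \<in> M \<Longrightarrow> Old v \<in> f' \<Longrightarrow> f' = f"
      by (elim ex1E) blast
    have "f \<in> E'" using M f(1) by (auto simp: perfect_matching_def)
    then obtain e where e: "e \<in> E" "e \<inter> S \<noteq> {}" "f = emb e"
      using f(2) unfolding E'_def by (elim UnE imageE) auto
    show ?thesis
    proof (rule ex1I[of _ e])
      show "e \<in> N M \<and> v \<in> e" using e f by (simp add: N_def)
      fix e' assume e': "e' \<in> N M \<and> v \<in> e'"
      then have "emb e' = emb e" using uniq[of "emb e'"] e(3) v by (simp add: N_def)
      then show "e' = e" using inj_onD[OF inj_on_emb, of e' e] e e' by (simp add: N_def)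
    qed
  qed
  have "\<not> boundary E A \<subseteq> N M\<^sub>1 \<inter> N M\<^sub>2" if "saturated A" "odd (card (boundary E A))" for A
  proof
    assume "boundary E A \<subseteq> N M\<^sub>1 \<inter> N M\<^sub>2"
    then have "boundary E' (lift A) \<subseteq> M\<^sub>1 \<inter> M\<^sub>2"
      unfolding boundary_lift[OF that(1)] by (auto simp: N_def)
    then show False
      using cut[rule_format, OF lift_subset, of A] card_boundary_lift[OF that(1)] that(2) by simp
  qed
  moreover have "N M\<^sub>1 \<subseteq> E" "N M\<^sub>2 \<subseteq> E" by (auto simp: N_def)
  ultimately show ?thesis
    using match M by (intro exI[of _ "N M\<^sub>1"] exI[of _ "N M\<^sub>2"]) simp
qed

end

subsection \<open>Disjoint copies\<close>

definition copies :: "'a set set \<Rightarrow> (nat \<times> 'a) set set" where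
  "copies E = (\<Union>n. (`) (Pair n) ` E)"

lemma inj_Pair_image: "inj ((`) (Pair n))"
  by (rule injI) (simp add: inj_image_eq_iff inj_on_def)

lemma simple_copies:
  assumes "simple_graph V E"
  shows "simple_graph (UNIV \<times> V) (copies E)"
  using assms by (auto simp: simple_graph_def copies_def card_image inj_on_def)

lemma cubic_copies:
  assumes "cubic V E"
  shows "cubic (UNIV \<times> V) (copies E)"
  unfolding cubic_def degree_def
proof
  fix x :: "nat \<times> 'a" assume "x \<in> UNIV \<times> V"
  then obtain n v where x: "x = (n, v)" "v \<in> V" by auto
  have "{f \<in> copies E. x \<in> f} = (`) (Pair n) ` {e \<in> E. v \<in> e}"
    by (auto simp: copies_def x(1))
  moreover have "card ((`) (Pair n) ` {e \<in> E. v \<in> e}) = card {e \<in> E. v \<in> e}"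
    by (rule card_image[OF inj_on_subset[OF inj_Pair_image]]) simp
  ultimately show "card {f \<in> copies E. x \<in> f} = 3"
    using assms x(2) by (simp add: cubic_def degree_def)
qed

text \<open>The edge of a one-edge cut lies in a single copy, and the trace of \<open>B\<close> on
  that copy is a one-edge cut of the original graph.\<close>

lemma bridgeless_copies:
  assumes simple: "simple_graph V E" and "bridgeless V E"
  shows "bridgeless (UNIV \<times> V) (copies E)"
  unfolding bridgeless_iff_boundary[OF simple_copies[OF simple]]
proof (intro allI impI notI)
  fix B assume "card (boundary (copies E) B) = 1"
  then obtain f where f: "boundary (copies E) B = {f}" by (auto simp: card_1_singleton_iff)
  then have "f \<in> copies E" using boundary_subset by blast
  then obtain n e where e: "f = Pair n ` e" "e \<in> E" by (auto simp: copies_def)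
  let ?A = "{v \<in> V. (n, v) \<in> B}"
  have "d \<in> boundary E ?A \<longleftrightarrow> d = e" for d
  proof (cases "d \<in> E")
    case True
    then have "d \<subseteq> V" using simple by (simp add: simple_graph_def)
    then have "d \<in> boundary E ?A \<longleftrightarrow> Pair n ` d \<in> boundary (copies E) B"
      using True by (auto simp: boundary_def copies_def)
    also have "\<dots> \<longleftrightarrow> d = e"
      using f e(1) inj_eq[OF inj_Pair_image] by simp
    finally show ?thesis .
  next
    case False
    then show ?thesis using e(2) by (auto simp: boundary_def)
  qed
  then have "boundary E ?A = {e}" by blast
  then have "card (boundary E ?A) = 1" by simp
  moreover have "?A \<subseteq> V" by blast
  ultimately show False using assms(2) bridgeless_iff_boundary[OF simple] by blast
qed

lemma has_pair_of_copies:
  assumes "simple_graph V E" "has_matching_pair_without_odd_cut (UNIV \<times> V) (copies E)"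
  shows "has_matching_pair_without_odd_cut V E"
proof (rule has_pair_embedding[OF _ assms(1) simple_copies[OF assms(1)] _ _ _ assms(2)])
  fix d assume d: "d \<in> copies E" "d \<inter> Pair 0 ` V \<noteq> {}"
  then show "d \<in> (`) (Pair 0) ` E" by (auto simp: copies_def)
qed (auto simp: copies_def inj_on_def)

text \<open>The countable union of copies is injected into \<open>'b\<close> through the natural
  numbers. Copies of the empty graph are not infinite, so that graph is treated directly, with empty
  matchings.\<close>

lemma finite_pair_if_infinite:
  fixes V :: "'a set"
  assumes inf: "infinite (UNIV :: 'b set)"
    and pair: "\<And>(W :: 'b set) F. simple_graph W F \<Longrightarrow> infinite W \<Longrightarrow> bridgeless W F \<Longrightarrow> cubic W F \<Longrightarrow>
      has_matching_pair_without_odd_cut W F"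
    and G: "simple_graph V E" "finite V" "bridgeless V E" "cubic V E"
  shows "has_matching_pair_without_odd_cut V E"
proof (cases "V = {}")
  case True
  then have "boundary E A = {}" if "A \<subseteq> V" for A
    using that by (simp add: boundary_def)
  then show ?thesis
    unfolding has_pair_iff_boundary[OF G(1)]
    using True by (intro exI[of _ "{}"]) (simp add: perfect_matching_def)
next
  case False
  obtain h :: "nat \<Rightarrow> 'b" where h: "inj h"
    using infinite_countable_subset[OF inf] by blast
  let ?W = "UNIV \<times> V :: (nat \<times> 'a) set"
  let ?f = "h \<circ> to_nat_on ?W"
  have "countable ?W" using G(2) by (simp add: countable_finite)
  then have f: "inj_on ?f ?W"
    by (intro comp_inj_on inj_on_to_nat_on inj_on_subset[OF h]) auto
  have inf': "infinite (?f ` ?W)"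
    unfolding finite_image_iff[OF f] using False by (simp add: finite_cartesian_product_iff)
  note copies = simple_copies[OF G(1)] bridgeless_copies[OF G(1,3)] cubic_copies[OF G(4)]
  have "has_matching_pair_without_odd_cut (?f ` ?W) ((`) ?f ` copies E)"
    by (rule pair[OF simple_graph_image[OF f copies(1)] inf' bridgeless_image[OF f copies(1,2)]
          cubic_image[OF f copies(1,3)]])
  then show ?thesis
    by (rule has_pair_of_copies[OF G(1) has_pair_image_imp[OF f copies(1)]])
qed

subsection \<open>From finite to infinite graphs\<close>

text \<open>The finite case is assumed over one vertex type, while expansions live over another. A
  finite graph has an isomorphic copy over any infinite type.\<close>

lemma has_pair_of_finite_in_other_type:
  fixes V :: "'c set"
  assumes inf: "infinite (UNIV :: 'a set)"
    and pair: "\<And>(W :: 'a set) F. simple_graph W F \<Longrightarrow> finite W \<Longrightarrow> bridgeless W F \<Longrightarrow> cubic W F \<Longrightarrow>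
      has_matching_pair_without_odd_cut W F"
    and G: "simple_graph V E" "finite V" "bridgeless V E" "cubic V E"
  shows "has_matching_pair_without_odd_cut V E"
proof -
  obtain B :: "'a set" where "finite B" "card B = card V"
    using infinite_arbitrarily_large[OF inf] by blast
  then obtain f where "bij_betw f V B"
    using G(2) finite_same_card_bij by metis
  then have f: "inj_on f V" by (rule bij_betw_imp_inj_on)
  show ?thesis
    by (rule has_pair_image_imp[OF f G(1) pair[OF simple_graph_image[OF f G(1)] finite_imageI[OF G(2)]
            bridgeless_image[OF f G(1,3)] cubic_image[OF f G(1,4)]]])
qed

text \<open>This is the finite satisfiability that compactness asks for: \<open>X\<close> and
  \<open>\<A>\<close> collect the vertices and sides named by finitely many requirements.\<close>

lemma local_matching_pair:
  fixes V :: "'b set"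
  assumes pair: "\<And>(W :: 'b expansion set) F. simple_graph W F \<Longrightarrow> finite W \<Longrightarrow> bridgeless W F \<Longrightarrow>
      cubic W F \<Longrightarrow> has_matching_pair_without_odd_cut W F"
    and G: "simple_graph V E" "bridgeless V E" "cubic V E"
    and X: "finite X" "X \<subseteq> V"
    and \<A>: "finite \<A>" "\<And>A. A \<in> \<A> \<Longrightarrow> odd (card (boundary E A))"
  shows "\<exists>N\<^sub>1 N\<^sub>2. N\<^sub>1 \<subseteq> E \<and> N\<^sub>2 \<subseteq> E \<and> (\<forall>v\<in>X. (\<exists>!e. e \<in> N\<^sub>1 \<and> v \<in> e) \<and> (\<exists>!e. e \<in> N\<^sub>2 \<and> v \<in> e)) \<and>
    (\<forall>A\<in>\<A>. \<not> boundary E A \<subseteq> N\<^sub>1 \<inter> N\<^sub>2)"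
proof -
  have edge: "finite e" "e \<subseteq> V" if "e \<in> E" for e
    using G(1) that by (auto simp: simple_graph_def intro: card_ge_0_finite)
  define S where "S = X \<union> (\<Union>A\<in>\<A>. \<Union> (boundary E A))"
  have S: "S \<subseteq> V" "finite S"
  proof -
    have "finite (boundary E A)" if "A \<in> \<A>" for A
      using \<A>(2)[OF that] by (intro card_ge_0_finite) (simp add: odd_pos)
    then show "finite S"
      using X(1) \<A>(1) edge(1) boundary_subset[of E] unfolding S_def by (intro finite_UnI finite_UN_I finite_Union) auto
    show "S \<subseteq> V" unfolding S_def using X(2) edge(2) boundary_subset[of E] by blast
  qed
  \<comment> \<open>Vertices of equal type lie on the same side of every cut in \<open>\<A>\<close>,
    which makes each of these sides \<open>saturated\<close>.\<close>
  define \<tau> where "\<tau> v = {A \<in> \<A>. v \<in> A}" for v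
  have type_edge: "\<tau> u = \<tau> v" if "e \<in> E" "u \<in> e" "v \<in> e" "u \<notin> S" "v \<notin> S" for e u v
  proof -
    have "u \<in> A \<longleftrightarrow> v \<in> A" if "A \<in> \<A>" for A
    proof (rule ccontr)
      assume "(u \<in> A) \<noteq> (v \<in> A)"
      then have "e \<in> boundary E A" using \<open>e \<in> E\<close> \<open>u \<in> e\<close> \<open>v \<in> e\<close> by (auto simp: boundary_def)
      then have "u \<in> S" using \<open>A \<in> \<A>\<close> \<open>u \<in> e\<close> by (auto simp: S_def)
      then show False using \<open>u \<notin> S\<close> by simp
    qed
    then show ?thesis by (auto simp: \<tau>_def)
  qed
  have fin: "finite (boundary E S)"
    by (rule finite_boundary[OF G(3) S])
  obtain \<sigma> where \<sigma>: "bij_betw \<sigma> (boundary E S) (boundary E S)"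
    "\<forall>e\<in>boundary E S. \<tau> ` (\<sigma> e - S) = \<tau> ` (e - S)"
    "\<forall>X\<subseteq>boundary E S. \<sigma> ` X \<subseteq> X \<longrightarrow>
      (\<forall>e\<in>X. \<forall>e'\<in>boundary E S. \<tau> ` (e' - S) = \<tau> ` (e - S) \<longrightarrow> e' \<in> X)"
    using ex_cyclic_on_fibres[OF fin, of "\<lambda>e. \<tau> ` (e - S)"] by (elim exE conjE)
  interpret vertex_expansion V E S \<tau> \<sigma>
    by unfold_locales (fact G S type_edge \<sigma>(1) \<sigma>(2)[rule_format] \<sigma>(3)[rule_format])+
  have "has_matching_pair_without_odd_cut V' E'"
    by (rule pair[OF simple_expansion finite_V' bridgeless_expansion cubic_expansion])
  from matching_pair_restrict[OF this] obtain N\<^sub>1 N\<^sub>2 where N: "N\<^sub>1 \<subseteq> E" "N\<^sub>2 \<subseteq> E"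
    "\<forall>v\<in>S. (\<exists>!e. e \<in> N\<^sub>1 \<and> v \<in> e) \<and> (\<exists>!e. e \<in> N\<^sub>2 \<and> v \<in> e)"
    "\<forall>A. saturated A \<longrightarrow> odd (card (boundary E A)) \<longrightarrow> \<not> boundary E A \<subseteq> N\<^sub>1 \<inter> N\<^sub>2"
    by (elim exE conjE)
  have "\<not> boundary E A \<subseteq> N\<^sub>1 \<inter> N\<^sub>2" if A: "A \<in> \<A>" for A
  proof -
    have "saturated A"
      unfolding saturated_def
    proof (intro ballI impI)
      fix u v assume "\<tau> u = \<tau> v"
      then have "A \<in> \<tau> u \<longleftrightarrow> A \<in> \<tau> v" by simp
      then show "u \<in> A \<longleftrightarrow> v \<in> A" using A by (simp add: \<tau>_def)
    qed
    then show ?thesis using N(4) \<A>(2)[OF A] by simp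
  qed
  moreover have "X \<subseteq> S" by (simp add: S_def)
  ultimately show ?thesis
    using N by (intro exI[of _ N\<^sub>1] exI[of _ N\<^sub>2]) (simp add: subset_iff)
qed

text \<open>The requirement at a vertex depends on its three edges only, and the one for an odd cut
  on the finitely many edges of that cut.\<close>

lemma pair_if_local_pairs:
  fixes V :: "'b set"
  assumes simple: "simple_graph V E" and cubic: "cubic V E"
    and local: "\<And>X \<A>. finite X \<Longrightarrow> X \<subseteq> V \<Longrightarrow> finite \<A> \<Longrightarrow> \<forall>A\<in>\<A>. odd (card (boundary E A)) \<Longrightarrow>
      \<exists>N\<^sub>1 N\<^sub>2. N\<^sub>1 \<subseteq> E \<and> N\<^sub>2 \<subseteq> E \<and> (\<forall>v\<in>X. (\<exists>!e. e \<in> N\<^sub>1 \<and> v \<in> e) \<and> (\<exists>!e. e \<in> N\<^sub>2 \<and> v \<in> e)) \<and>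
        (\<forall>A\<in>\<A>. \<not> boundary E A \<subseteq> N\<^sub>1 \<inter> N\<^sub>2)"
  shows "has_matching_pair_without_odd_cut V E"
proof -
  \<comment> \<open>One Boolean function codes both edge sets; the bit \<open>b\<close> tells which
    of the two is meant.\<close>
  define N where "N b x = {e \<in> E. x (e, b)}" for b and x :: "'b set \<times> bool \<Rightarrow> bool"
  define P where "P v = {x. \<forall>b. \<exists>!e. e \<in> N b x \<and> v \<in> e}" for v
  define Q where "Q A = {x. \<not> boundary E A \<subseteq> N True x \<inter> N False x}" for A
  define \<O> where "\<O> = {A. odd (card (boundary E A))}"
  have "\<Inter> (P ` V \<union> Q ` \<O>) \<noteq> {}"
  proof (rule compactness)
    fix C assume "C \<in> P ` V \<union> Q ` \<O>"
    then consider v where "v \<in> V" "C = P v" | A where "A \<in> \<O>" "C = Q A" by blast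
    then show "\<exists>J. finite J \<and> (\<forall>x y. (\<forall>j\<in>J. x j = y j) \<longrightarrow> x \<in> C \<longrightarrow> y \<in> C)"
    proof cases
      case 1
      have "finite {e \<in> E. v \<in> e}"
        by (rule finite_incident[OF cubic 1(1)])
      moreover have "y \<in> C" if eq: "\<forall>j\<in>{e \<in> E. v \<in> e} \<times> UNIV. x j = y j" and x: "x \<in> C" for x y
      proof -
        have "e \<in> N b x \<and> v \<in> e \<longleftrightarrow> e \<in> N b y \<and> v \<in> e" for e b
          using eq by (auto simp: N_def)
        then show ?thesis using x unfolding 1(2) P_def by simp
      qed
      ultimately show ?thesis
        by (intro exI[of _ "{e \<in> E. v \<in> e} \<times> UNIV"] conjI allI impI finite_cartesian_product) auto
    next
      case 2
      have "finite (boundary E A)"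
        using 2(1) by (intro card_ge_0_finite) (simp add: \<O>_def odd_pos)
      moreover have "y \<in> C" if eq: "\<forall>j\<in>boundary E A \<times> UNIV. x j = y j" and x: "x \<in> C" for x y
      proof -
        obtain e where e: "e \<in> boundary E A" "e \<notin> N True x \<inter> N False x"
          using x unfolding 2(2) Q_def by blast
        have "e \<in> N b x \<longleftrightarrow> e \<in> N b y" for b
          using eq e(1) by (simp add: N_def)
        then show ?thesis using e unfolding 2(2) Q_def by blast
      qed
      ultimately show ?thesis
        by (intro exI[of _ "boundary E A \<times> UNIV"] conjI allI impI finite_cartesian_product) auto
    qed
  next
    fix \<F> assume \<F>: "finite \<F>" "\<F> \<subseteq> P ` V \<union> Q ` \<O>"
    \<comment> \<open>Finitely many requirements come from finitely many vertices \<open>X\<close>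
      and sides \<open>\<A>\<close>.\<close>
    obtain X where X: "X \<subseteq> V" "finite X" "\<F> \<inter> P ` V = P ` X"
      using finite_subset_image[of "\<F> \<inter> P ` V" P V] \<F>(1) by auto
    obtain \<A> where \<A>: "\<A> \<subseteq> \<O>" "finite \<A>" "\<F> \<inter> Q ` \<O> = Q ` \<A>"
      using finite_subset_image[of "\<F> \<inter> Q ` \<O>" Q \<O>] \<F>(1) by auto
    have "\<forall>A\<in>\<A>. odd (card (boundary E A))" using \<A>(1) by (auto simp: \<O>_def)
    from local[OF X(2,1) \<A>(2) this] obtain N\<^sub>1 N\<^sub>2 where N12: "N\<^sub>1 \<subseteq> E" "N\<^sub>2 \<subseteq> E"
      "\<forall>v\<in>X. (\<exists>!e. e \<in> N\<^sub>1 \<and> v \<in> e) \<and> (\<exists>!e. e \<in> N\<^sub>2 \<and> v \<in> e)"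
      "\<forall>A\<in>\<A>. \<not> boundary E A \<subseteq> N\<^sub>1 \<inter> N\<^sub>2"
      by (elim exE conjE)
    define x where "x = (\<lambda>(e, b). if b then e \<in> N\<^sub>1 else e \<in> N\<^sub>2)"
    have N: "N True x = N\<^sub>1" "N False x = N\<^sub>2"
      using N12(1,2) by (auto simp: N_def x_def)
    have "x \<in> P v" if "v \<in> X" for v
      using N12(3) that by (simp add: P_def N all_bool_eq)
    moreover have "x \<in> Q A" if "A \<in> \<A>" for A
      using N12(4) that by (simp add: Q_def N)
    moreover have "\<F> = P ` X \<union> Q ` \<A>"
      unfolding X(3)[symmetric] \<A>(3)[symmetric] using \<F>(2) by auto
    ultimately have "x \<in> \<Inter>\<F>" by auto
    then show "\<Inter>\<F> \<noteq> {}" by auto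
  qed
  then obtain x where x: "x \<in> \<Inter> (P ` V \<union> Q ` \<O>)" by blast
  have "perfect_matching V E (N b x)" for b
    unfolding perfect_matching_def
  proof (intro conjI ballI)
    show "N b x \<subseteq> E" by (auto simp: N_def)
    fix v assume "v \<in> V"
    then have "x \<in> P v" using x by blast
    then show "\<exists>!e. e \<in> N b x \<and> v \<in> e" by (simp add: P_def)
  qed
  moreover have "\<not> boundary E A \<subseteq> N True x \<inter> N False x" if "odd (card (boundary E A))" for A
  proof -
    have "x \<in> Q A" using x that by (auto simp: \<O>_def)
    then show ?thesis by (simp add: Q_def)
  qed
  ultimately show ?thesis
    unfolding has_pair_iff_boundary[OF simple] by (intro exI[of _ "N True x"] exI[of _ "N False x"]) simp
qed

text \<open>Each statement concerns graphs over one fixed vertex type. An infinite \<open>'a\<close>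
  has room for a copy of every finite graph; over a finite \<open>'b\<close> the second statement
  would be vacuous.\<close>

theorem theorem3p4:
  assumes "infinite (UNIV :: 'a set)" and "infinite (UNIV :: 'b set)"
  shows
    "(\<forall>(V :: 'a set) E. simple_graph V E \<and> finite V \<and> bridgeless V E \<and> cubic V E
        \<longrightarrow> has_matching_pair_without_odd_cut V E)
     \<longleftrightarrow>
     (\<forall>(V :: 'b set) E. simple_graph V E \<and> infinite V \<and> bridgeless V E \<and> cubic V E
        \<longrightarrow> has_matching_pair_without_odd_cut V E)"
    (is "?fin \<longleftrightarrow> ?inf")
proof
  assume fin: ?fin
  show ?inf
  proof (intro allI impI, elim conjE)
    fix V :: "'b set" and E
    assume G: "simple_graph V E" "bridgeless V E" "cubic V E"
    have pair: "has_matching_pair_without_odd_cut W F"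
      if "simple_graph W F" "finite W" "bridgeless W F" "cubic W F" for W :: "'b expansion set" and F
      using has_pair_of_finite_in_other_type[OF assms(1) _ that] fin by simp
    show "has_matching_pair_without_odd_cut V E"
      by (rule pair_if_local_pairs[OF G(1,3)], rule local_matching_pair[OF pair G]) simp_all
  qed
next
  assume inf: ?inf
  show ?fin
  proof (intro allI impI, elim conjE)
    fix V :: "'a set" and E
    assume "simple_graph V E" "finite V" "bridgeless V E" "cubic V E"
    then show "has_matching_pair_without_odd_cut V E"
      using finite_pair_if_infinite[OF assms(2)] inf by simp
  qed
qed

end
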